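(* Let $\big((a_1,\dots,a_k),(b_1,\dots,b_\ell)\big)$ be a bipartite degree sequence with $\ell\le k$. Let $n'=2\ell$, $m=\sum_{i=1}^k a_i$ and $m^*=2\sum_{i=1}^k\min(a_i,\ell-a_i)$. Then for all pairs of realizations $B_1,B_2$ of this bipartite degree sequence, $$\mathbf{dist}_u(B_1,B_2)\le H'(B_1,B_2)\cdot(1-2/n')\le m^*(1/2-1/n')\le m(1-2/n').$$
   Context: Bipartite graphs are finite and simple, with fixed labeled vertex classes $U=\{u_1,\dots,u_k\}$ and $W=\{w_1,\dots,w_\ell\}$. The bipartite degree sequence of $B$ is $\big((d(u_1),\dots,d(u_k)),(d(w_1),\dots,d(w_\ell))\big)$; $B$ is then a realization of it. Swap (bipartite): if $a,b\in U$ are different, $c,d\in W$ are different, $(a,c),(b,d)\in E(B)$ and $(b,c),(a,d)\notin E(B)$, then a swap replaces the edges $(a,c),(b,d)$ by $(b,c),(a,d)$. $\mathbf{dist}_u(B_1,B_2)$ is the length (number of swaps) of a shortest sequence of such swaps transforming $B_1$ into $B_2$. $H'(B_1,B_2)=|E(B_1)\,\Delta\, E(B_2)|/2$, where $\Delta$ is the symmetric difference. *)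

theory Defs
  imports Complex_Main "HOL-Library.Extended_Nat" "HOL-Library.Extended_Real"
begin

text \<open>
  A bipartite graph with labeled classes \<open>U = {u_1, ..., u_k}\<close> and
  \<open>W = {w_1, ..., w_l}\<close> is given by its edge set; the pair \<open>(i, j)\<close> stands for
  the edge \<open>u_i w_j\<close>, so the two classes are disjoint even though both are indexed from 1.
\<close>

definition bip_graph :: "nat \<Rightarrow> nat \<Rightarrow> (nat \<times> nat) set \<Rightarrow> bool" where
  "bip_graph k l B \<longleftrightarrow> B \<subseteq> {1..k} \<times> {1..l}"

definition deg_U :: "(nat \<times> nat) set \<Rightarrow> nat \<Rightarrow> nat" where
  "deg_U B i = card {j. (i, j) \<in> B}"

definition deg_W :: "(nat \<times> nat) set \<Rightarrow> nat \<Rightarrow> nat" where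
  "deg_W B j = card {i. (i, j) \<in> B}"

definition realization ::
    "nat \<Rightarrow> nat \<Rightarrow> (nat \<Rightarrow> nat) \<Rightarrow> (nat \<Rightarrow> nat) \<Rightarrow> (nat \<times> nat) set \<Rightarrow> bool" where
  "realization k l a b B \<longleftrightarrow> bip_graph k l B \<and>
     (\<forall>i\<in>{1..k}. deg_U B i = a i) \<and> (\<forall>j\<in>{1..l}. deg_W B j = b j)"

definition bip_degree_sequence ::
    "nat \<Rightarrow> nat \<Rightarrow> (nat \<Rightarrow> nat) \<Rightarrow> (nat \<Rightarrow> nat) \<Rightarrow> bool" where
  "bip_degree_sequence k l a b \<longleftrightarrow> (\<exists>B. realization k l a b B)"

definition swap_step ::
    "nat \<Rightarrow> nat \<Rightarrow> (nat \<times> nat) set \<Rightarrow> (nat \<times> nat) set \<Rightarrow> bool" where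
  "swap_step k l B B' \<longleftrightarrow>
     (\<exists>a\<in>{1..k}. \<exists>b\<in>{1..k}. \<exists>c\<in>{1..l}. \<exists>d\<in>{1..l}.
        a \<noteq> b \<and> c \<noteq> d \<and>
        (a, c) \<in> B \<and> (b, d) \<in> B \<and> (b, c) \<notin> B \<and> (a, d) \<notin> B \<and>
        B' = (B - {(a, c), (b, d)}) \<union> {(b, c), (a, d)})"

text \<open>
  The distance takes values in \<^typ>\<open>enat\<close>: it is \<open>\<infinity>\<close> if no sequence of swaps transforms
  \<open>B1\<close> into \<open>B2\<close>, so a finite upper bound includes the existence of such a sequence.
\<close>

definition dist_u :: "nat \<Rightarrow> nat \<Rightarrow> (nat \<times> nat) set \<Rightarrow> (nat \<times> nat) set \<Rightarrow> enat" where
  "dist_u k l B1 B2 = (INF n\<in>{n. (swap_step k l ^^ n) B1 B2}. enat n)"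

definition H' :: "(nat \<times> nat) set \<Rightarrow> (nat \<times> nat) set \<Rightarrow> real" where
  "H' B1 B2 = real (card (sym_diff B1 B2)) / 2"

end

theory Submission
  imports Defs
begin

text \<open>
  In the symmetric difference of two realizations every vertex meets as many edges of the first
  as of the second realization, so following edges of the two kinds alternately produces an
  alternating cycle without repeated vertices; it has length \<open>2 p\<close> with \<open>p \<le> l\<close>. Exchanging
  the edges along such a cycle takes \<open>p - 1\<close> swaps, by cutting off a 4-cycle with a chord, and
  \<open>p - 1 \<le> p (1 - 1 / l)\<close>. Removing such cycles one by one uses up the symmetric difference
  and gives the first inequality. The other two follow from comparing the neighbourhoods of each
  vertex of \<open>U\<close>.
\<close>

section \<open>Swaps along an alternating cycle\<close>

lemma swap_stepI:
  assumes "x \<in> {1..k}" "y \<in> {1..k}" "c \<in> {1..l}" "d \<in> {1..l}" "x \<noteq> y" "c \<noteq> d"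
    and "(x, c) \<in> B" "(y, d) \<in> B" "(y, c) \<notin> B" "(x, d) \<notin> B"
    and "B' = (B - {(x, c), (y, d)}) \<union> {(y, c), (x, d)}"
  shows "swap_step k l B B'"
  unfolding swap_step_def
  by (rule bexI[of _ x], rule bexI[of _ y], rule bexI[of _ c], rule bexI[of _ d])
    (use assms in simp_all)

text \<open>Bookkeeping for joining a shorter cycle to one swap: the shorter cycle removes
  \<open>R\<close> and adds \<open>insert p N\<close>, where \<open>p\<close> is a chord, and the
  swap exchanges \<open>p\<close>, \<open>q\<close> for \<open>r\<close>, \<open>z\<close>. Here the
  swap comes last; in \<open>exchange_before\<close> it comes first.\<close>

lemma exchange_after:
  assumes "p \<in> R \<or> p \<notin> B" "p \<notin> N" "q \<notin> N"
  shows "(B - insert q R) \<union> insert z (insert r N)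
    = (((B - R) \<union> insert p N) - {p, q}) \<union> {r, z}"
  using assms by blast

lemma exchange_before:
  assumes "p \<in> B" "p \<notin> R" "p \<noteq> q" "r \<notin> R" "z \<notin> R"
  shows "((((B - {p, q}) \<union> {r, z}) - R) \<union> insert p N)
    = (B - insert q R) \<union> insert z (insert r N)"
  using assms by blast

text \<open>
  The cycle is \<open>u 0, w 0, u 1, w 1, \<dots>, u t, w t\<close>. For \<open>t = 0\<close> it degenerates to a single
  edge that is removed and added again.
\<close>
lemma alternating_cycle_swaps:
  assumes "inj_on u {..t}" "inj_on w {..t}"
    and "u ` {..t} \<subseteq> {1..k}" "w ` {..t} \<subseteq> {1..l}"
    and "\<And>i. i \<le> t \<Longrightarrow> (u i, w i) \<in> B"
    and "\<And>i. i < t \<Longrightarrow> (u (Suc i), w i) \<notin> B"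
    and "0 < t \<Longrightarrow> (u 0, w t) \<notin> B"
  shows "(swap_step k l ^^ t) B
    ((B - (\<lambda>i. (u i, w i)) ` {..t}) \<union> insert (u 0, w t) ((\<lambda>i. (u (Suc i), w i)) ` {..<t}))"
  using assms
proof (induction t arbitrary: B)
  case 0
  then show ?case by (auto simp: insert_absorb)
next
  case (Suc s)
  let ?R = "\<lambda>t. (\<lambda>i. (u i, w i)) ` {..t}"
  let ?N = "\<lambda>t. (\<lambda>i. (u (Suc i), w i)) ` {..<t}"
  let ?x = "u 0" and ?y = "u (Suc s)" and ?c = "w s" and ?d = "w (Suc s)"
  have u_eq: "u i = u j \<longleftrightarrow> i = j" if "i \<le> Suc s" "j \<le> Suc s" for i j
    using Suc.prems(1) that by (simp add: inj_on_eq_iff)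
  have w_eq: "w i = w j \<longleftrightarrow> i = j" if "i \<le> Suc s" "j \<le> Suc s" for i j
    using Suc.prems(2) that by (simp add: inj_on_eq_iff)
  have xy: "?x \<noteq> ?y" and cd: "?c \<noteq> ?d" by (simp_all add: u_eq w_eq)
  have mem: "?x \<in> {1..k}" "?y \<in> {1..k}" "?c \<in> {1..l}" "?d \<in> {1..l}"
    using Suc.prems(3,4) by (auto simp: image_subset_iff)
  have red: "(?y, ?d) \<in> B" and blue: "(?y, ?c) \<notin> B" "(?x, ?d) \<notin> B"
    using Suc.prems(5-7) by auto
  have inj: "inj_on u {..s}" "inj_on w {..s}" "u ` {..s} \<subseteq> {1..k}" "w ` {..s} \<subseteq> {1..l}"
    using Suc.prems(1-4) by (auto intro: inj_on_subset)
  have R_Suc: "?R (Suc s) = insert (?y, ?d) (?R s)" by (simp add: atMost_Suc)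
  have N_Suc: "?N (Suc s) = insert (?y, ?c) (?N s)" by (simp add: lessThan_Suc)
  have notin_R: "(?y, ?d) \<notin> ?R s" "(?y, ?c) \<notin> ?R s" "(?x, ?d) \<notin> ?R s"
    by (auto simp: u_eq w_eq)
  have notin_N: "(?y, ?d) \<notin> ?N s" "(?x, ?d) \<notin> ?N s" "(?x, ?c) \<notin> ?N s" "(?y, ?c) \<notin> ?N s"
    by (auto simp: u_eq w_eq)
  show ?case
  \<comment> \<open>The chord \<open>(?x, ?c)\<close> cuts the cycle into a shorter cycle and a
    4-cycle. If it is a nonedge, the shorter cycle goes first and inserts it, and the last swap
    removes it again. For \<open>s = 0\<close> it is the edge \<open>(u 0, w 0)\<close> itself and
    the shorter cycle costs no swap.\<close>
  proof (cases "s = 0 \<or> (?x, ?c) \<notin> B")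
    case True
    let ?B' = "(B - ?R s) \<union> insert (?x, ?c) (?N s)"
    have "(swap_step k l ^^ s) B ?B'"
      using True Suc.prems(5-7) by (intro Suc.IH inj) auto
    moreover have "swap_step k l ?B'
        ((B - ?R (Suc s)) \<union> insert (?x, ?d) (?N (Suc s)))"
    proof (rule swap_stepI[OF mem xy cd])
      have "(?x, ?c) \<in> ?R s \<or> (?x, ?c) \<notin> B" using True by auto
      then show "(B - ?R (Suc s)) \<union> insert (?x, ?d) (?N (Suc s))
          = (?B' - {(?x, ?c), (?y, ?d)}) \<union> {(?y, ?c), (?x, ?d)}"
        unfolding R_Suc N_Suc by (intro exchange_after notin_N)
    qed (use red blue notin_R notin_N in auto)
    ultimately show ?thesis by (rule relpowp_Suc_I)
  next
    case False
    \<comment> \<open>With the chord present the order is reversed: the swap on the 4-cycle removes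
      it, so the shorter cycle then finds its closing pair free and puts it back.\<close>
    let ?B' = "(B - {(?x, ?c), (?y, ?d)}) \<union> {(?y, ?c), (?x, ?d)}"
    have first: "swap_step k l B ?B'"
      by (rule swap_stepI[OF mem xy cd]) (use red blue False in auto)
    have rest: "(swap_step k l ^^ s) ?B' ((?B' - ?R s) \<union> insert (?x, ?c) (?N s))"
    proof (intro Suc.IH inj)
      show "(u i, w i) \<in> ?B'" if "i \<le> s" for i
        using that False Suc.prems(5)[of i] by (auto simp: u_eq w_eq)
      show "(u (Suc i), w i) \<notin> ?B'" if "i < s" for i
        using that Suc.prems(6)[of i] by (auto simp: u_eq w_eq)
      show "(?x, ?c) \<notin> ?B'" if "0 < s"
        using that xy cd by auto
    qed
    have eq: "(?B' - ?R s) \<union> insert (?x, ?c) (?N s)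
        = (B - ?R (Suc s)) \<union> insert (?x, ?d) (?N (Suc s))"
    proof -
      have "(?x, ?c) \<notin> ?R s" using False by (auto simp: u_eq w_eq)
      then show ?thesis
        unfolding R_Suc N_Suc using False xy by (intro exchange_before notin_R) auto
    qed
    show ?thesis using relpowp_Suc_I2[OF first rest] unfolding eq .
  qed
qed

section \<open>Cycles of a self-map of a finite set\<close>

lemma finite_self_map_cycle:
  assumes "finite S" "S \<noteq> {}" and f: "\<And>x. x \<in> S \<Longrightarrow> f x \<in> S"
  obtains p x where "0 < p" "x \<in> S" "(f ^^ p) x = x" "inj_on (\<lambda>i. (f ^^ i) x) {..<p}"
proof -
  have iter: "(f ^^ n) x \<in> S" if "x \<in> S" for n x
    using that f by (induction n) auto
  have shift: "(f ^^ (j - i)) ((f ^^ i) x) = (f ^^ i) x"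
    if "i \<le> j" "(f ^^ i) x = (f ^^ j) x" for i j x
    using that by (metis comp_apply funpow_add le_add_diff_inverse2)
  \<comment> \<open>The period is minimized over all points of \<open>S\<close> at once: a
    repetition among the first \<open>p\<close> iterates would make one of them periodic with a
    smaller period.\<close>
  let ?P = "\<lambda>p. 0 < p \<and> (\<exists>x\<in>S. (f ^^ p) x = x)"
  obtain x0 where x0: "x0 \<in> S" using \<open>S \<noteq> {}\<close> by blast
  have "\<not> inj (\<lambda>n. (f ^^ n) x0)"
    using finite_imageD[of "\<lambda>n. (f ^^ n) x0" UNIV] iter[OF x0] \<open>finite S\<close>
    by (metis finite_subset image_subsetI infinite_UNIV_nat)
  then obtain i j where "i < j" "(f ^^ i) x0 = (f ^^ j) x0"
    by (metis injI linorder_less_linear)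
  then have "?P (j - i)" using shift[of i j x0] iter[OF x0, of i] by auto
  then have least: "?P (LEAST p. ?P p)" by (rule LeastI)
  define p where "p = (LEAST p. ?P p)"
  obtain x where x: "0 < p" "x \<in> S" "(f ^^ p) x = x" using least unfolding p_def by blast
  have "(f ^^ i) x \<noteq> (f ^^ j) x" if "i < j" "j < p" for i j
  proof
    assume "(f ^^ i) x = (f ^^ j) x"
    then have "?P (j - i)" using shift[of i j x] iter[OF x(2), of i] that by auto
    then have "p \<le> j - i" unfolding p_def by (rule Least_le)
    with that show False by linarith
  qed
  then have "inj_on (\<lambda>i. (f ^^ i) x) {..<p}"
    by (intro linorder_inj_onI) (auto dest: sym)
  with x that show thesis by blast
qed

section \<open>Degrees and alternating cycles in the symmetric difference\<close>

lemma bip_graph_finite: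
  assumes "bip_graph k l B"
  shows "finite B"
  using assms finite_subset unfolding bip_graph_def by blast

lemma bip_graph_finite_nbrs:
  assumes "bip_graph k l B"
  shows "finite {j. (i, j) \<in> B}" "finite {i. (i, j) \<in> B}"
  using assms finite_subset[of "{j. (i, j) \<in> B}" "{1..l}"]
    finite_subset[of "{i. (i, j) \<in> B}" "{1..k}"]
  unfolding bip_graph_def by auto

lemma swap_step_realization:
  assumes "swap_step k l B B'" "realization k l a b B"
  shows "realization k l a b B'"
proof -
  obtain x y c d where mem: "x \<in> {1..k}" "y \<in> {1..k}" "c \<in> {1..l}" "d \<in> {1..l}"
    and ne: "x \<noteq> y" "c \<noteq> d"
    and edges: "(x, c) \<in> B" "(y, d) \<in> B" "(y, c) \<notin> B" "(x, d) \<notin> B"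
    and B': "B' = (B - {(x, c), (y, d)}) \<union> {(y, c), (x, d)}"
    using assms(1) unfolding swap_step_def by blast
  have bip: "bip_graph k l B" using assms(2) by (simp add: realization_def)
  have exchange: "card (insert q (A - {p})) = card A"
    if "finite A" "p \<in> A" "q \<notin> A" for A :: "nat set" and p q
    using that card_Suc_Diff1 by fastforce
  have "deg_U B' i = deg_U B i" for i
  proof -
    have "{j. (i, j) \<in> B'} = (if i = x then insert d ({j. (i, j) \<in> B} - {c})
        else if i = y then insert c ({j. (i, j) \<in> B} - {d}) else {j. (i, j) \<in> B})"
      using ne by (auto simp: B')
    then show ?thesis
      unfolding deg_U_def using edges exchange bip_graph_finite_nbrs(1)[OF bip] by auto
  qed
  moreover have "deg_W B' j = deg_W B j" for j
  proof -
    have "{i. (i, j) \<in> B'} = (if j = c then insert y ({i. (i, j) \<in> B} - {x})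
        else if j = d then insert x ({i. (i, j) \<in> B} - {y}) else {i. (i, j) \<in> B})"
      using ne by (auto simp: B')
    then show ?thesis
      unfolding deg_W_def using edges exchange bip_graph_finite_nbrs(2)[OF bip] by auto
  qed
  moreover have "bip_graph k l B'"
    using bip mem by (auto simp: bip_graph_def B')
  ultimately show ?thesis using assms(2) by (simp add: realization_def)
qed

lemma swap_steps_realization:
  assumes "(swap_step k l ^^ n) B B'" "realization k l a b B"
  shows "realization k l a b B'"
  using assms
  by (induction n arbitrary: B') (auto intro: swap_step_realization)

lemma card_eq_Diff_nonempty:
  assumes "finite A" "finite C" "card A = card C" "A - C \<noteq> {}"
  shows "C - A \<noteq> {}"
  using assms card_seteq[of A C] by auto

text \<open>The two neighbourhoods of \<open>i\<close> have equal size, so a surplus on one side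
  forces a surplus on the other. Together with \<open>realization_nbr_W\<close> this lets an
  alternating walk always continue.\<close>

lemma realization_nbr_U:
  assumes "realization k l a b B1" "realization k l a b B2" "(i, j) \<in> B2 - B1"
  shows "\<exists>j'. (i, j') \<in> B1 - B2"
proof -
  have "i \<in> {1..k}" and bip: "bip_graph k l B1" "bip_graph k l B2"
    using assms by (auto simp: realization_def bip_graph_def)
  then have "card {j. (i, j) \<in> B2} = card {j. (i, j) \<in> B1}"
    using assms(1,2) by (simp add: realization_def deg_U_def)
  from card_eq_Diff_nonempty[OF bip_graph_finite_nbrs(1)[OF bip(2)]
      bip_graph_finite_nbrs(1)[OF bip(1)] this]
  show ?thesis using assms(3) by blast
qed

lemma realization_nbr_W:
  assumes "realization k l a b B1" "realization k l a b B2" "(i, j) \<in> B1 - B2"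
  shows "\<exists>i'. (i', j) \<in> B2 - B1"
proof -
  have "j \<in> {1..l}" and bip: "bip_graph k l B1" "bip_graph k l B2"
    using assms by (auto simp: realization_def bip_graph_def)
  then have "card {i. (i, j) \<in> B1} = card {i. (i, j) \<in> B2}"
    using assms(1,2) by (simp add: realization_def deg_W_def)
  from card_eq_Diff_nonempty[OF bip_graph_finite_nbrs(2)[OF bip(1)]
      bip_graph_finite_nbrs(2)[OF bip(2)] this]
  show ?thesis using assms(3) by blast
qed

text \<open>Choosing one edge of \<open>B2 - B1\<close> at each vertex of \<open>?S\<close> (by
  \<open>g\<close>) and one edge of \<open>B1 - B2\<close> at each vertex reached (by
  \<open>h\<close>) makes the alternating walk deterministic. Its double step \<open>f\<close> maps
  \<open>?S\<close> to itself, and a periodic orbit of \<open>f\<close> gives the cycle.\<close>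

lemma realization_alternating_cycle:
  assumes r1: "realization k l a b B1" and r2: "realization k l a b B2" and "B1 \<noteq> B2"
  obtains u t w where "inj_on u {..t}" "inj_on w {..t}"
    "\<forall>i\<le>t. (u i, w i) \<in> B1 - B2"
    "\<forall>i<t. (u (Suc i), w i) \<in> B2 - B1" "(u 0, w t) \<in> B2 - B1"
proof -
  let ?S = "snd ` (B1 - B2)"
  have "finite ?S"
    using r1 bip_graph_finite by (auto simp: realization_def)
  moreover have "?S \<noteq> {}"
  proof
    assume "?S = {}"
    then have "B2 - B1 \<noteq> {}" using \<open>B1 \<noteq> B2\<close> by auto
    then obtain i j where "(i, j) \<in> B2 - B1" by auto
    from realization_nbr_U[OF r1 r2 this] \<open>?S = {}\<close> show False by auto
  qed
  moreover obtain g where g: "\<And>j. j \<in> ?S \<Longrightarrow> (g j, j) \<in> B2 - B1"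
  proof -
    have "\<forall>j\<in>?S. \<exists>i'. (i', j) \<in> B2 - B1"
      using realization_nbr_W[OF r1 r2] by (metis imageE prod.collapse)
    then show thesis using that bchoice by metis
  qed
  moreover obtain h where h: "\<And>j. j \<in> ?S \<Longrightarrow> (g j, h (g j)) \<in> B1 - B2"
  proof -
    have "\<forall>i\<in>g ` ?S. \<exists>j'. (i, j') \<in> B1 - B2"
      using realization_nbr_U[OF r1 r2] g by blast
    then obtain h where "\<forall>i\<in>g ` ?S. (i, h i) \<in> B1 - B2" using bchoice by metis
    then show thesis using that by blast
  qed
  define f where "f j = h (g j)" for j
  have f: "f j \<in> ?S" if "j \<in> ?S" for j
    using h[OF that] unfolding f_def by force
  ultimately obtain p y where p: "0 < p" and y: "y \<in> ?S" and fp: "(f ^^ p) y = y"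
    and inj: "inj_on (\<lambda>i. (f ^^ i) y) {..<p}"
    using finite_self_map_cycle[of ?S f] f by metis
  obtain t where t: "p = Suc t" using p gr0_conv_Suc by blast
  define w where "w i = (f ^^ i) y" for i
  \<comment> \<open>Since \<open>w i\<close> has to follow \<open>u i\<close>, the vertex chosen by
    \<open>g\<close> at \<open>w i\<close> gets index \<open>Suc i\<close>; the one chosen at
    \<open>w t\<close> closes the cycle and becomes \<open>u 0\<close>.\<close>
  define u where "u i = (case i of 0 \<Rightarrow> g (w t) | Suc i' \<Rightarrow> g (w i'))" for i
  have w_in: "w i \<in> ?S" for i
    unfolding w_def using y f by (induction i) auto
  \<comment> \<open>For \<open>i = 0\<close> this is the periodicity of \<open>y\<close>. As
    \<open>h\<close> recovers \<open>w i\<close> from \<open>u i\<close>, injectivity of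
    \<open>u\<close> follows from that of \<open>w\<close>.\<close>
  have hu: "h (u i) = w i" for i
    using fp by (cases i) (simp_all add: u_def w_def t f_def)
  show thesis
  proof (rule that[of u _ w])
    show w: "inj_on w {..t}" using inj by (simp add: w_def[abs_def] t lessThan_Suc_atMost)
    show "inj_on u {..t}"
      by (rule inj_onI) (metis hu w inj_onD)
    have "(u i, w i) \<in> B1 - B2" for i
    proof -
      obtain j where "u i = g (w j)" by (cases i) (auto simp: u_def)
      then show ?thesis using h[OF w_in[of j]] hu[of i] by simp
    qed
    then show "\<forall>i\<le>t. (u i, w i) \<in> B1 - B2" by blast
    show "\<forall>i<t. (u (Suc i), w i) \<in> B2 - B1" using g[OF w_in] by (simp add: u_def)
    show "(u 0, w t) \<in> B2 - B1" using g[OF w_in] by (simp add: u_def)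
  qed
qed

section \<open>Removing the cycles one by one\<close>

lemma card_sym_diff_exchange:
  assumes "finite A" "finite C" "R \<subseteq> A - C" "N \<subseteq> C - A"
  shows "card (sym_diff ((A - R) \<union> N) C) + (card R + card N) = card (sym_diff A C)"
proof -
  have fin: "finite R" "finite N" using assms finite_subset by blast+
  have "sym_diff ((A - R) \<union> N) C \<union> (R \<union> N) = sym_diff A C" using assms(3,4) by blast
  moreover have "card (sym_diff ((A - R) \<union> N) C \<union> (R \<union> N))
      = card (sym_diff ((A - R) \<union> N) C) + card (R \<union> N)"
    using assms fin by (intro card_Un_disjoint) auto
  moreover have "card (R \<union> N) = card R + card N"
    using assms(3,4) fin by (intro card_Un_disjoint) auto
  ultimately show ?thesis by simp
qed

lemma realization_swaps:
  assumes "realization k l a b B1" "realization k l a b B2"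
  shows "\<exists>n. (swap_step k l ^^ n) B1 B2 \<and> real n \<le> H' B1 B2 * (1 - 1 / real l)"
  using assms(1)
proof (induction "card (sym_diff B1 B2)" arbitrary: B1 rule: less_induct)
  case less
  note r1 = less.prems and r2 = assms(2)
  show ?case
  proof (cases "B1 = B2")
    case True
    then have "(swap_step k l ^^ 0) B1 B2 \<and> real 0 \<le> H' B1 B2 * (1 - 1 / real l)"
      by (simp add: H'_def)
    then show ?thesis by blast
  next
    case False
    obtain u t w where inj: "inj_on u {..t}" "inj_on w {..t}"
      and red: "\<forall>i\<le>t. (u i, w i) \<in> B1 - B2"
      and blue: "\<forall>i<t. (u (Suc i), w i) \<in> B2 - B1" "(u 0, w t) \<in> B2 - B1"
      using realization_alternating_cycle[OF r1 r2 False] .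
    have bip: "B1 \<subseteq> {1..k} \<times> {1..l}" "finite B1" "finite B2"
      using r1 r2 bip_graph_finite by (auto simp: realization_def bip_graph_def)
    have uk: "u ` {..t} \<subseteq> {1..k}" and wl: "w ` {..t} \<subseteq> {1..l}"
      using red bip(1) by blast+
    define R where "R = (\<lambda>i. (u i, w i)) ` {..t}"
    define N where "N = insert (u 0, w t) ((\<lambda>i. (u (Suc i), w i)) ` {..<t})"
    let ?B = "(B1 - R) \<union> N"
    have steps: "(swap_step k l ^^ t) B1 ?B"
      unfolding R_def N_def
      using red blue by (intro alternating_cycle_swaps inj uk wl) auto
    \<comment> \<open>Projecting to W shows that \<open>R\<close> and \<open>N\<close> have at least
      \<open>Suc t\<close> edges each. Hence \<open>t\<close> swaps lower \<open>H'\<close> by at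
      least \<open>Suc t\<close>, and the induction hypothesis applies to \<open>?B\<close>.\<close>
    have card_w: "card (w ` {..t}) = Suc t" using inj(2) by (simp add: card_image)
    have "snd ` R = w ` {..t}" by (simp add: R_def image_image)
    moreover have "snd ` N = w ` {..t}"
      by (simp add: N_def image_image flip: lessThan_Suc_atMost) (simp add: lessThan_Suc)
    moreover have "finite R" "finite N" by (simp_all add: R_def N_def)
    ultimately have card_RN: "Suc t \<le> card R" "Suc t \<le> card N"
      using card_image_le[of R snd] card_image_le[of N snd] card_w by simp_all
    have "R \<subseteq> B1 - B2" "N \<subseteq> B2 - B1" using red blue by (auto simp: R_def N_def)
    note card_sym_diff_exchange[OF bip(2,3) this]
    moreover have "2 * Suc t \<le> card R + card N" using add_mono[OF card_RN] by (simp only: mult_2)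
    ultimately have decr: "card (sym_diff ?B B2) + 2 * Suc t \<le> card (sym_diff B1 B2)"
      by (metis add_left_mono)
    obtain n where n: "(swap_step k l ^^ n) ?B B2" "real n \<le> H' ?B B2 * (1 - 1 / real l)"
      using less.hyps[of ?B] decr swap_steps_realization[OF steps r1] by auto
    have "(swap_step k l ^^ (t + n)) B1 B2"
      unfolding relpowp_add using steps n(1) by (rule relcomppI)
    moreover have "real (t + n) \<le> H' B1 B2 * (1 - 1 / real l)"
    proof -
      \<comment> \<open>The cycle visits \<open>Suc t\<close> different vertices of W. This gives
        \<open>t / Suc t\<close> \<le> \<open>1 - 1 / l\<close>, and also \<open>l > 0\<close>, so
        that the factor is nonnegative.\<close>
      have tl: "real (Suc t) \<le> real l"
        using card_mono[OF _ wl] card_w by simp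
      then have "real t \<le> real (Suc t) * (1 - 1 / real l)"
        by (simp add: field_simps)
      moreover have "H' ?B B2 + real (Suc t) \<le> H' B1 B2"
        using decr unfolding H'_def by (simp add: field_simps)
      then have "(H' ?B B2 + real (Suc t)) * (1 - 1 / real l) \<le> H' B1 B2 * (1 - 1 / real l)"
        using tl by (intro mult_right_mono) (auto simp: field_simps)
      ultimately show ?thesis using n(2) by (simp add: distrib_right)
    qed
    ultimately show ?thesis by blast
  qed
qed

section \<open>Bounding \<open>H'\<close> through neighbourhoods of vertices of U\<close>

lemma card_sym_diff_same_card:
  assumes "A \<subseteq> {1..l::nat}" "C \<subseteq> {1..l}" "card A = c" "card C = c"
  shows "real (card (sym_diff A C)) \<le> 2 * min (real c) (real l - real c)"
proof -
  have fin: "finite A" "finite C" using assms(1,2) finite_subset by blast+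
  have "card (sym_diff A C) = card (A - C) + card (C - A)"
    using fin by (intro card_Un_disjoint) auto
  \<comment> \<open>Each difference lies in one of the sets and misses the other; the first fact
    bounds it by \<open>c\<close>, the second by \<open>l - c\<close>.\<close>
  moreover have "card (A - C) \<le> c" "card (C - A) \<le> c"
    using card_mono[OF fin(1), of "A - C"] card_mono[OF fin(2), of "C - A"] assms by auto
  moreover have "card (A - C) + c \<le> l" "card (C - A) + c \<le> l"
  proof -
    have "card X + card Y \<le> l" if "X \<subseteq> {1..l}" "Y \<subseteq> {1..l}" "X \<inter> Y = {}" for X Y
      using card_mono[of "{1..l}" "X \<union> Y"] that finite_subset[of _ "{1..l}"]
      by (simp add: card_Un_disjoint)
    from this[of "A - C" C] this[of "C - A" A] assms
    show "card (A - C) + c \<le> l" "card (C - A) + c \<le> l" by auto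
  qed
  ultimately show ?thesis by (simp add: min_def)
qed

text \<open>The symmetric difference is sliced by vertices of U. The slice at \<open>i\<close>
  compares two subsets of \<open>{1..l}\<close> of the same size \<open>a i\<close>.\<close>

lemma H'_le:
  assumes "realization k l a b B1" "realization k l a b B2"
  shows "H' B1 B2 \<le> (\<Sum>i=1..k. min (real (a i)) (real l - real (a i)))"
proof -
  let ?N = "\<lambda>B i. {j. (i, j) \<in> B}"
  have bip: "B1 \<subseteq> {1..k} \<times> {1..l}" "B2 \<subseteq> {1..k} \<times> {1..l}"
    using assms by (auto simp: realization_def bip_graph_def)
  have sub: "?N B1 i \<subseteq> {1..l}" "?N B2 i \<subseteq> {1..l}" for i
    using bip by auto
  have "sym_diff B1 B2 = (SIGMA i:{1..k}. sym_diff (?N B1 i) (?N B2 i))"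
    using bip by auto
  moreover have "finite (sym_diff (?N B1 i) (?N B2 i))" for i
    using sub[of i] finite_subset by blast
  ultimately have "card (sym_diff B1 B2) = (\<Sum>i=1..k. card (sym_diff (?N B1 i) (?N B2 i)))"
    by simp
  also have "real \<dots> \<le> (\<Sum>i=1..k. 2 * min (real (a i)) (real l - real (a i)))"
    unfolding of_nat_sum using assms sub
    by (intro sum_mono card_sym_diff_same_card) (auto simp: realization_def deg_U_def)
  finally show ?thesis
    by (simp add: H'_def sum_distrib_left[symmetric])
qed

theorem theorem4p1:
  fixes k l :: nat and a b :: "nat \<Rightarrow> nat"
    and n' m mstar :: real
    and B1 B2 :: "(nat \<times> nat) set"
  assumes "bip_degree_sequence k l a b"
    and "l \<le> k"
    and "n' = 2 * real l"
    and "m = (\<Sum>i=1..k. real (a i))"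
    and "mstar = 2 * (\<Sum>i=1..k. min (real (a i)) (real l - real (a i)))"
    and "realization k l a b B1"
    and "realization k l a b B2"
  shows "ereal_of_enat (dist_u k l B1 B2) \<le> ereal (H' B1 B2 * (1 - 2 / n'))
    \<and> H' B1 B2 * (1 - 2 / n') \<le> mstar * (1 / 2 - 1 / n')
    \<and> mstar * (1 / 2 - 1 / n') \<le> m * (1 - 2 / n')"
proof (intro conjI)
  have q: "1 - 2 / n' = 1 - 1 / real l"
    using assms(3) by simp
  \<comment> \<open>For \<open>l = 0\<close> division by zero yields 0, so the factor is 1.\<close>
  have q0: "0 \<le> 1 - 2 / n'"
    unfolding q by (cases "l = 0") simp_all
  \<comment> \<open>With the common factor split off, the last two inequalities reduce to
    \<open>H' B1 B2\<close> \<le> \<open>mstar / 2\<close> \<le> \<open>m\<close>.\<close>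
  have half: "mstar * (1 / 2 - 1 / n') = mstar / 2 * (1 - 2 / n')"
    by (simp add: algebra_simps)
  obtain n where n: "(swap_step k l ^^ n) B1 B2" "real n \<le> H' B1 B2 * (1 - 2 / n')"
    using realization_swaps[OF assms(6,7)] unfolding q by blast
  have "dist_u k l B1 B2 \<le> enat n"
    unfolding dist_u_def using n(1) by (intro INF_lower) simp
  then have "ereal_of_enat (dist_u k l B1 B2) \<le> ereal (real n)"
    by (metis ereal_of_enat_le_iff ereal_of_enat_simps(1))
  with n(2) show "ereal_of_enat (dist_u k l B1 B2) \<le> ereal (H' B1 B2 * (1 - 2 / n'))"
    by (meson ereal_less_eq(3) order_trans)
  show "H' B1 B2 * (1 - 2 / n') \<le> mstar * (1 / 2 - 1 / n')"
    unfolding half using H'_le[OF assms(6,7)] q0 by (intro mult_right_mono) (auto simp: assms(5))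
  have "mstar / 2 \<le> m"
    by (auto simp: assms(4,5) intro: sum_mono)
  then show "mstar * (1 / 2 - 1 / n') \<le> m * (1 - 2 / n')"
    unfolding half using q0 by (rule mult_right_mono)
qed

end
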